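(* Let $I=\langle -p^n+P,\,-\bar p+Q\rangle$ with $P(p)=t_2p^{n-2}+\dots+t_n$ and $Q(p)=\mu_1+\mu_2p+\dots+\mu_np^{n-1}$, where $\mu_1=-\sum_{k=2}^{n-1}\frac{k}{n}t_k\mu_{k+1}$ modulo $t^2$. Then $$\{-p^n+P,\,-\bar p+Q\}=0 \mod I \mod t^2$$ if and only if $I\in T^*\hat{\mathcal{T}}^n$. (That is, the spectral curve $\tilde\Sigma\subset T^{*\mathbb{C}}\Sigma$ defined by $p^n=P$, $\bar p=Q$ is Lagrangian modulo $t^2$ if and only if the ideal comes from the cotangent bundle of the moduli space of $n$-complex structures.)
   Context: $\Sigma$ is a smooth closed connected oriented surface of genus $\geq 2$ with reference complex coordinate $z$, $\partial=\partial/\partial z$, $\bar\partial=\partial/\partial\bar z$; $p,\bar p$ are the induced independent linear coordinates on the fibers of $T^{*\mathbb{C}}\Sigma=T^*\Sigma\otimes\mathbb{C}$; $K=T^{*(1,0)}\Sigma$. The coefficients satisfy $\mu_k\in\Gamma(K^{1-k}\otimes\bar K)$ and $t_k\in\Gamma(K^k)$ for $2\le k\le n$ (smooth sections); $\mu_2,\dots,\mu_n$ are the higher Beltrami differentials of a compatible $n$-complex structure $\langle p^n,-\bar p+\mu_2p+\dots+\mu_np^{n-1}\rangle$, $|\mu_2|<1$. "Modulo $t^2$" means modulo terms at least quadratic in the $t_i$ (and their derivatives). The Poisson bracket is $\{H,f\}=\partial_pH\,\partial f-\partial H\,\partial_pf+\partial_{\bar p}H\,\bar\partial f-\bar\partial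 H\,\partial_{\bar p}f$. $\hat{\mathcal T}^n$ is the moduli space of compatible $n$-complex structures modulo higher diffeomorphisms (hamiltonian diffeomorphisms of $T^*\Sigma$ preserving the zero-section). The statement $I\in T^*\hat{\mathcal{T}}^n$ means concretely that $(\mu_k,t_k)_{2\le k\le n}$ represents a cotangent vector to $\hat{\mathcal T}^n$, i.e. that for all $k\in\{2,\dots,n\}$ $$(-\bar\partial+\mu_2\partial+k\,\partial\mu_2)t_k+\sum_{l=1}^{n-k}\big((l+k)\,\partial\mu_{l+2}+(l+1)\mu_{l+2}\partial\big)t_{k+l}=0 .$$ *)

theory Defs
  imports
    "HOL-Analysis.Analysis"
    "HOL-Homology.Homology"
    "HOL-Computational_Algebra.Computational_Algebra"
begin

subsection \<open>Wirtinger derivatives and smooth functions\<close>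

definition d_z :: "(complex \<Rightarrow> complex) \<Rightarrow> complex \<Rightarrow> complex" where
  "d_z f z = (frechet_derivative f (at z) 1 - \<i> * frechet_derivative f (at z) \<i>) / 2"

definition d_zbar :: "(complex \<Rightarrow> complex) \<Rightarrow> complex \<Rightarrow> complex" where
  "d_zbar f z = (frechet_derivative f (at z) 1 + \<i> * frechet_derivative f (at z) \<i>) / 2"

text \<open>Differentiability below is over the reals; the two Frechet derivatives taken are the
  partial derivatives in the real and in the imaginary direction.\<close>

primrec Ck_on :: "nat \<Rightarrow> complex set \<Rightarrow> (complex \<Rightarrow> complex) \<Rightarrow> bool" where
  "Ck_on 0 S f \<longleftrightarrow> continuous_on S f"
| "Ck_on (Suc m) S f \<longleftrightarrow> f differentiable_on S
      \<and> Ck_on m S (\<lambda>z. frechet_derivative f (at z) 1)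
      \<and> Ck_on m S (\<lambda>z. frechet_derivative f (at z) \<i>)"

definition smooth_fun_on :: "complex set \<Rightarrow> (complex \<Rightarrow> complex) \<Rightarrow> bool" where
  "smooth_fun_on S f \<longleftrightarrow> (\<forall>m. Ck_on m S f)"


subsection \<open>Closed Riemann surfaces and tensors of type \<open>K\<^sup>a \<otimes> Kbar\<^sup>b\<close>\<close>

type_synonym 'a chart = "'a set \<times> ('a \<Rightarrow> complex)"

abbreviation chart_dom :: "'a chart \<Rightarrow> 'a set" where "chart_dom c \<equiv> fst c"
abbreviation chart_map :: "'a chart \<Rightarrow> 'a \<Rightarrow> complex" where "chart_map c \<equiv> snd c"
abbreviation chart_img :: "'a chart \<Rightarrow> complex set" where "chart_img c \<equiv> chart_map c ` chart_dom c"

definition transition :: "'a chart \<Rightarrow> 'a chart \<Rightarrow> complex \<Rightarrow> complex" where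
  "transition c c' = chart_map c' \<circ> inv_into (chart_dom c) (chart_map c)"

text \<open>A closed connected surface together with a holomorphic atlas; the atlas supplies both the
  orientation and the reference complex coordinates.\<close>

definition closed_riemann_surface :: "'a topology \<Rightarrow> 'a chart set \<Rightarrow> bool" where
  "closed_riemann_surface X A \<longleftrightarrow>
     Hausdorff_space X \<and> compact_space X \<and> connected_space X \<and>
     (\<Union>c\<in>A. chart_dom c) = topspace X \<and>
     (\<forall>c\<in>A. openin X (chart_dom c) \<and> open (chart_img c) \<and>
        homeomorphic_map (subtopology X (chart_dom c)) (top_of_set (chart_img c)) (chart_map c)) \<and>
     (\<forall>c\<in>A. \<forall>c'\<in>A. transition c c' holomorphic_on chart_map c ` (chart_dom c \<inter> chart_dom c'))"

definition has_genus :: "'a topology \<Rightarrow> nat \<Rightarrow> bool" where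
  "has_genus X g \<longleftrightarrow> homology_group 1 X \<cong> free_Abelian_group {..<2 * g}"

text \<open>A smooth section of \<open>K\<^sup>a \<otimes> Kbar\<^sup>b\<close> is given by its local coefficient
  functions: \<open>s c\<close> is the coefficient of \<open>dz\<^sup>a dzbar\<^sup>b\<close> in the chart \<open>c\<close>, and
  only its values on \<open>chart_img c\<close> matter.\<close>

definition smooth_section ::
  "'a chart set \<Rightarrow> int \<Rightarrow> int \<Rightarrow> ('a chart \<Rightarrow> complex \<Rightarrow> complex) \<Rightarrow> bool" where
  "smooth_section A a b s \<longleftrightarrow>
     (\<forall>c\<in>A. smooth_fun_on (chart_img c) (s c)) \<and>
     (\<forall>c\<in>A. \<forall>c'\<in>A. \<forall>x\<in>chart_dom c \<inter> chart_dom c'.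
        s c (chart_map c x) =
          s c' (chart_map c' x) * deriv (transition c c') (chart_map c x) powi a
            * cnj (deriv (transition c c') (chart_map c x)) powi b)"


subsection \<open>Fibrewise polynomial functions and the Poisson bracket\<close>

text \<open>Terms of degree \<open>d\<close> in the \<open>t\<^sub>k\<close> and their derivatives are tracked by a
  formal parameter \<open>\<epsilon> = fps_X\<close>, constant under all derivatives: every \<open>t\<^sub>k\<close> is
  replaced by \<open>\<epsilon> t\<^sub>k\<close>, so that a differential monomial of degree \<open>d\<close> in the
  \<open>t\<^sub>k\<close> acquires exactly the factor \<open>\<epsilon>\<^sup>d\<close>, and ``modulo \<open>t\<^sup>2\<close>'' is
  ``modulo \<open>\<epsilon>\<^sup>2\<close>''.

  The functions on the restriction of the complexified cotangent bundle to a chart are families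
  \<open>H z\<close> of polynomials in the fibre coordinates: the inner polynomial variable is \<open>p\<close>, the
  outer one is \<open>pbar\<close>.\<close>

type_synonym fibre_poly = "complex fps poly poly"

definition scal :: "complex fps \<Rightarrow> fibre_poly" where "scal a = [:[:a:]:]"
definition var_p :: fibre_poly where "var_p = [:[:0, 1:]:]"
definition var_pbar :: fibre_poly where "var_pbar = [:0, 1:]"

text \<open>Coefficientwise application of a derivative in the base. \<open>lift_poly\<close> is meaningful when
  the degrees of the \<open>H z\<close> are bounded in \<open>z\<close>, as \<open>Abs_poly\<close> needs finitely many nonzero
  coefficients; \<open>gen_F\<close> and \<open>gen_G\<close> below have this property.\<close>

definition lift_fps ::
  "((complex \<Rightarrow> complex) \<Rightarrow> complex \<Rightarrow> complex) \<Rightarrow> (complex \<Rightarrow> complex fps) \<Rightarrow> complex \<Rightarrow> complex fps" where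
  "lift_fps D f z = Abs_fps (\<lambda>m. D (\<lambda>w. fps_nth (f w) m) z)"

definition lift_poly ::
  "((complex \<Rightarrow> 'b::zero) \<Rightarrow> complex \<Rightarrow> 'b) \<Rightarrow> (complex \<Rightarrow> 'b poly) \<Rightarrow> complex \<Rightarrow> 'b poly" where
  "lift_poly D H z = Abs_poly (\<lambda>i. D (\<lambda>w. Polynomial.coeff (H w) i) z)"

definition base_d :: "(complex \<Rightarrow> fibre_poly) \<Rightarrow> complex \<Rightarrow> fibre_poly" where
  "base_d = lift_poly (lift_poly (lift_fps d_z))"

definition base_dbar :: "(complex \<Rightarrow> fibre_poly) \<Rightarrow> complex \<Rightarrow> fibre_poly" where
  "base_dbar = lift_poly (lift_poly (lift_fps d_zbar))"

definition fibre_d_p :: "(complex \<Rightarrow> fibre_poly) \<Rightarrow> complex \<Rightarrow> fibre_poly" where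
  "fibre_d_p H z = map_poly pderiv (H z)"

definition fibre_d_pbar :: "(complex \<Rightarrow> fibre_poly) \<Rightarrow> complex \<Rightarrow> fibre_poly" where
  "fibre_d_pbar H z = pderiv (H z)"

definition poisson ::
  "(complex \<Rightarrow> fibre_poly) \<Rightarrow> (complex \<Rightarrow> fibre_poly) \<Rightarrow> complex \<Rightarrow> fibre_poly" where
  "poisson H f z =
     fibre_d_p H z * base_d f z - base_d H z * fibre_d_p f z
     + fibre_d_pbar H z * base_dbar f z - base_dbar H z * fibre_d_pbar f z"

text \<open>As for \<open>n\<close>-complex structures, an ideal is a family, over the points of the base, of
  ideals in the polynomial ring of the fibre.\<close>

definition ideal2 :: "'b::comm_ring_1 \<Rightarrow> 'b \<Rightarrow> 'b set" where
  "ideal2 f g = {a * f + b * g | a b. True}"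

definition zero_mod_ideal_mod_t2 :: "fibre_poly \<Rightarrow> fibre_poly set \<Rightarrow> bool" where
  "zero_mod_ideal_mod_t2 x I \<longleftrightarrow> (\<exists>i\<in>I. scal (fps_X ^ 2) dvd x - i)"


subsection \<open>The ideal and the cotangent condition\<close>

text \<open>\<open>gen_F\<close> is \<open>-p\<^sup>n + P\<close> and \<open>gen_G\<close> is \<open>-pbar + Q\<close>, in one chart.\<close>

definition gen_F :: "nat \<Rightarrow> (nat \<Rightarrow> complex \<Rightarrow> complex) \<Rightarrow> complex \<Rightarrow> fibre_poly" where
  "gen_F n t z = - (var_p ^ n) + (\<Sum>k=2..n. scal (fps_X * fps_const (t k z)) * var_p ^ (n - k))"

definition gen_G ::
  "nat \<Rightarrow> (complex \<Rightarrow> complex fps) \<Rightarrow> (nat \<Rightarrow> complex \<Rightarrow> complex) \<Rightarrow> complex \<Rightarrow> fibre_poly" where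
  "gen_G n \<mu>1 \<mu> z =
     - var_pbar + scal (\<mu>1 z) + (\<Sum>k=2..n. scal (fps_const (\<mu> k z)) * var_p ^ (k - 1))"

definition higher_beltrami ::
  "'a chart set \<Rightarrow> nat \<Rightarrow> (nat \<Rightarrow> 'a chart \<Rightarrow> complex \<Rightarrow> complex) \<Rightarrow> bool" where
  "higher_beltrami A n \<mu> \<longleftrightarrow>
     (\<forall>k\<in>{2..n}. smooth_section A (1 - int k) 1 (\<mu> k)) \<and>
     (\<forall>c\<in>A. \<forall>z\<in>chart_img c. cmod (\<mu> 2 c z) < 1)"

text \<open>\<open>\<mu>\<^sub>1\<close> is only prescribed modulo \<open>t\<^sup>2\<close>, hence is a power series in \<open>\<epsilon>\<close>
  with arbitrary smooth sections of \<open>Kbar\<close> as coefficients from order two on.\<close>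

definition is_mu1 ::
  "'a chart set \<Rightarrow> nat \<Rightarrow> (nat \<Rightarrow> 'a chart \<Rightarrow> complex \<Rightarrow> complex) \<Rightarrow>
   (nat \<Rightarrow> 'a chart \<Rightarrow> complex \<Rightarrow> complex) \<Rightarrow> ('a chart \<Rightarrow> complex \<Rightarrow> complex fps) \<Rightarrow> bool" where
  "is_mu1 A n \<mu> t \<mu>1 \<longleftrightarrow>
     (\<forall>m. smooth_section A 0 1 (\<lambda>c z. fps_nth (\<mu>1 c z) m)) \<and>
     (\<forall>c\<in>A. \<forall>z\<in>chart_img c.
        fps_X ^ 2 dvd \<mu>1 c z -
          (- (\<Sum>k=2..n-1. fps_const (of_nat k / of_nat n)
                * (fps_X * fps_const (t k c z)) * fps_const (\<mu> (k + 1) c z))))"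

definition in_cotangent_moduli ::
  "'a chart set \<Rightarrow> nat \<Rightarrow> (nat \<Rightarrow> 'a chart \<Rightarrow> complex \<Rightarrow> complex) \<Rightarrow>
   (nat \<Rightarrow> 'a chart \<Rightarrow> complex \<Rightarrow> complex) \<Rightarrow> bool" where
  "in_cotangent_moduli A n \<mu> t \<longleftrightarrow>
     (\<forall>k\<in>{2..n}. \<forall>c\<in>A. \<forall>z\<in>chart_img c.
        (- d_zbar (t k c) z + \<mu> 2 c z * d_z (t k c) z + of_nat k * d_z (\<mu> 2 c) z * t k c z)
        + (\<Sum>l=1..n-k. of_nat (l + k) * d_z (\<mu> (l + 2) c) z * t (k + l) c z
                      + of_nat (l + 1) * \<mu> (l + 2) c z * d_z (t (k + l) c) z) = 0)"

end

theory Submission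
  imports Defs
begin

text \<open>The bracket of the generators does not involve \<open>pbar\<close>, so substituting \<open>pbar = Q\<close> turns the
  membership question into divisibility of \<open>b = \<partial>\<^sub>pF \<partial>Q - \<partial>F \<partial>\<^sub>pQ + \<partial>barF\<close> by
  \<open>F = -p\<^sup>n + P\<close> modulo \<open>\<epsilon>\<^sup>2\<close>. The part of \<open>b\<close> of order zero in \<open>\<epsilon>\<close> is
  \<open>-n p^(n-1) \<partial>Q\<close>, a multiple of \<open>p\<^sup>n\<close>, so the order zero part of the quotient is forced and
  the condition becomes that an explicit polynomial, the order one remainder, is divisible by
  \<open>p\<^sup>n\<close>. Its coefficients at \<open>p^(n-k)\<close>, \<open>2 \<le> k \<le> n\<close>, are minus the left-hand sides of the
  cotangent equations, and the one at \<open>p^(n-1)\<close> vanishes because of the choice of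
  \<open>\<mu>\<^sub>1\<close>.\<close>

hide_const (open) UnivPoly.coeff UnivPoly.monom Module.smult

section \<open>Wirtinger derivatives\<close>

lemma d_z_has_derivative:
  assumes "(f has_derivative f') (at z)"
  shows "d_z f z = (f' 1 - \<i> * f' \<i>) / 2"
  using frechet_derivative_at[OF assms] by (simp add: d_z_def)

lemma d_zbar_has_derivative:
  assumes "(f has_derivative f') (at z)"
  shows "d_zbar f z = (f' 1 + \<i> * f' \<i>) / 2"
  using frechet_derivative_at[OF assms] by (simp add: d_zbar_def)

lemma d_z_const [simp]: "d_z (\<lambda>_. a) z = 0"
  by (simp add: d_z_has_derivative[OF has_derivative_const])

lemma d_zbar_const [simp]: "d_zbar (\<lambda>_. a) z = 0"
  by (simp add: d_zbar_has_derivative[OF has_derivative_const])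

text \<open>A derivative depends only on the germ at the point. This form is used because the
  prescription for \<open>\<mu>1\<close> holds only on \<open>chart_img c\<close>.\<close>

lemma d_z_cong_open:
  assumes "open S" "z \<in> S" "\<And>w. w \<in> S \<Longrightarrow> f w = g w" "g differentiable (at z)"
  shows "d_z f z = d_z g z"
proof -
  obtain g' where g': "(g has_derivative g') (at z)"
    using assms(4) by (auto simp: differentiable_def)
  have "(f has_derivative g') (at z)"
    by (rule has_derivative_transform_within_open[OF g' assms(1,2)]) (simp add: assms(3))
  then show ?thesis using g' by (simp add: d_z_has_derivative)
qed

lemma d_z_mult:
  assumes "f differentiable (at z)" "g differentiable (at z)"
  shows "d_z (\<lambda>w. f w * g w) z = d_z f z * g z + f z * d_z g z"
proof -
  obtain f' g' where fg: "(f has_derivative f') (at z)" "(g has_derivative g') (at z)"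
    using assms by (auto simp: differentiable_def)
  show ?thesis
    by (simp add: d_z_has_derivative[OF has_derivative_mult[OF fg]] d_z_has_derivative[OF fg(1)]
        d_z_has_derivative[OF fg(2)] field_simps)
qed

lemma d_z_sum:
  assumes "\<And>k. k \<in> I \<Longrightarrow> f k differentiable (at z)"
  shows "d_z (\<lambda>w. \<Sum>k\<in>I. f k w) z = (\<Sum>k\<in>I. d_z (f k) z)"
proof -
  obtain f' where f': "\<And>k. k \<in> I \<Longrightarrow> (f k has_derivative f' k) (at z)"
    using assms unfolding differentiable_def by metis
  have "d_z (\<lambda>w. \<Sum>k\<in>I. f k w) z = ((\<Sum>k\<in>I. f' k 1) - \<i> * (\<Sum>k\<in>I. f' k \<i>)) / 2"
    by (rule d_z_has_derivative) (rule has_derivative_sum, rule f')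
  also have "\<dots> = (\<Sum>k\<in>I. (f' k 1 - \<i> * f' k \<i>) / 2)"
    by (simp add: sum_subtractf sum_distrib_left sum_divide_distrib[symmetric])
  also have "\<dots> = (\<Sum>k\<in>I. d_z (f k) z)"
    by (rule sum.cong) (simp_all add: d_z_has_derivative[OF f'])
  finally show ?thesis .
qed

text \<open>The first level of smoothness gives differentiability within the chart image, and
  openness makes it differentiability at the point.\<close>

lemma smooth_section_differentiable:
  assumes "smooth_section A a b s" "c \<in> A" "open (chart_img c)" "z \<in> chart_img c"
  shows "s c differentiable (at z)"
proof -
  have "Ck_on (Suc 0) (chart_img c) (s c)"
    using assms(1,2) unfolding smooth_section_def smooth_fun_on_def by blast
  then have "s c differentiable_on chart_img c" by simp
  then show ?thesis
    using assms(3,4) differentiable_on_eq_differentiable_at by blast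
qed

section \<open>Coefficients of power series in \<open>\<epsilon>\<close>\<close>

text \<open>Modulo \<epsilon>^2 a polynomial in p is determined by its parts 0 and 1; the former is
  multiplicative, the latter obeys a Leibniz rule over it.\<close>

definition eps_part :: "nat \<Rightarrow> 'a::comm_ring_1 fps poly \<Rightarrow> 'a poly" where
  "eps_part m = map_poly (\<lambda>a. fps_nth a m)"

lemma coeff_eps_part [simp]: "coeff (eps_part m x) i = fps_nth (coeff x i) m"
  by (simp add: eps_part_def coeff_map_poly)

lemma eps_part_add: "eps_part m (x + y) = eps_part m x + eps_part m y"
  by (rule poly_eqI) simp

lemma eps_part_diff: "eps_part m (x - y) = eps_part m x - eps_part m y"
  by (rule poly_eqI) simp

lemma eps_part_pderiv: "eps_part m (pderiv x) = pderiv (eps_part m x)"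
  by (rule poly_eqI) (simp add: coeff_pderiv fps_of_nat[symmetric] del: of_nat_Suc)

lemma eps_part_0_mult: "eps_part 0 (x * y) = eps_part 0 x * eps_part 0 y"
  by (rule poly_eqI) (simp add: coeff_mult fps_sum_nth)

lemma eps_part_1_mult:
  "eps_part 1 (x * y) = eps_part 0 x * eps_part 1 y + eps_part 1 x * eps_part 0 y"
  by (rule poly_eqI) (simp add: coeff_mult fps_sum_nth fps_mult_nth_1 sum.distrib)

lemma X_power2_dvd_iff:
  fixes f :: "'a::comm_ring_1 fps"
  shows "fps_X ^ 2 dvd f \<longleftrightarrow> fps_nth f 0 = 0 \<and> fps_nth f 1 = 0"
proof
  assume "fps_X ^ 2 dvd f"
  then show "fps_nth f 0 = 0 \<and> fps_nth f 1 = 0"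
    by (auto simp: fps_X_power_mult_nth elim!: dvdE)
next
  assume "fps_nth f 0 = 0 \<and> fps_nth f 1 = 0"
  then have "fps_nth f n = 0" if "n < 2" for n
    using that by (cases n) auto
  then have "f = fps_X ^ 2 * Abs_fps (\<lambda>n. fps_nth f (n + 2))"
    by (intro fps_ext) (simp add: fps_X_power_mult_nth le_add_diff_inverse2 del: add_2_eq_Suc')
  then show "fps_X ^ 2 dvd f" by (rule dvdI)
qed

lemma X_power2_dvd_poly_iff:
  fixes x :: "complex fps poly"
  shows "[:fps_X ^ 2:] dvd x \<longleftrightarrow> eps_part 0 x = 0 \<and> eps_part 1 x = 0"
  unfolding const_poly_dvd_iff X_power2_dvd_iff poly_eq_iff coeff_eps_part by auto

text \<open>Here \<open>[:q, -1:]\<close> is q - pbar. Evaluation at pbar = q kills it and fixes b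
  and f, so membership becomes b = a f modulo \<epsilon>^2 in the single variable p; comparing
  orders zero and one gives the two equations.\<close>

lemma zero_mod_ideal_mod_t2_iff:
  "zero_mod_ideal_mod_t2 [:b:] (ideal2 [:f:] [:q, -1:]) \<longleftrightarrow>
     (\<exists>a0 a1. eps_part 0 b = a0 * eps_part 0 f \<and>
        eps_part 1 b = a0 * eps_part 1 f + a1 * eps_part 0 f)" (is "?L \<longleftrightarrow> ?R")
proof
  assume ?L
  then obtain a c where "scal (fps_X ^ 2) dvd [:b:] - (a * [:f:] + c * [:q, -1:])"
    by (auto simp: zero_mod_ideal_mod_t2_def ideal2_def)
  then obtain d where d: "[:b:] - (a * [:f:] + c * [:q, -1:]) = scal (fps_X ^ 2) * d" ..
  have "b - poly a q * f = [:fps_X ^ 2:] * poly d q"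
    using arg_cong[OF d, of "\<lambda>h. poly h q"] by (simp add: scal_def mult.commute)
  then have "[:fps_X ^ 2:] dvd b - poly a q * f" by (rule dvdI)
  then have "eps_part 0 b = eps_part 0 (poly a q) * eps_part 0 f"
    "eps_part 1 b = eps_part 0 (poly a q) * eps_part 1 f + eps_part 1 (poly a q) * eps_part 0 f"
    unfolding X_power2_dvd_poly_iff eps_part_diff eps_part_0_mult eps_part_1_mult by simp_all
  then show ?R by blast
next
  assume ?R
  then obtain a0 a1 where a: "eps_part 0 b = a0 * eps_part 0 f"
    "eps_part 1 b = a0 * eps_part 1 f + a1 * eps_part 0 f" by blast
  \<comment> \<open>The multiplier is a0 + \<epsilon> a1, and the second generator enters with
    factor 0.\<close>
  define a where "a = map_poly fps_const a0 + smult fps_X (map_poly fps_const a1)"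
  have "eps_part 0 a = a0" "eps_part 1 a = a1"
    by (auto simp: a_def poly_eq_iff coeff_map_poly fps_mult_nth_1)
  then have "[:fps_X ^ 2:] dvd b - a * f"
    unfolding X_power2_dvd_poly_iff eps_part_diff eps_part_0_mult eps_part_1_mult using a by simp
  then obtain d where "b - a * f = [:fps_X ^ 2:] * d" ..
  then have "[:b:] - ([:a:] * [:f:] + 0 * [:q, -1:]) = scal (fps_X ^ 2) * [:d:]"
    by (simp add: scal_def mult.commute)
  then have "scal (fps_X ^ 2) dvd [:b:] - ([:a:] * [:f:] + 0 * [:q, -1:])" by (rule dvdI)
  then show ?L unfolding zero_mod_ideal_mod_t2_def ideal2_def by blast
qed

section \<open>The generators and their bracket\<close>

definition F_poly :: "nat \<Rightarrow> (nat \<Rightarrow> complex \<Rightarrow> complex) \<Rightarrow> complex \<Rightarrow> complex fps poly" where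
  "F_poly n t z = - monom 1 n + (\<Sum>k=2..n. monom (fps_X * fps_const (t k z)) (n - k))"

definition Q_poly ::
  "nat \<Rightarrow> (complex \<Rightarrow> complex fps) \<Rightarrow> (nat \<Rightarrow> complex \<Rightarrow> complex) \<Rightarrow> complex \<Rightarrow> complex fps poly" where
  "Q_poly n \<mu>1 \<mu> z = [:\<mu>1 z:] + (\<Sum>k=2..n. monom (fps_const (\<mu> k z)) (k - 1))"

lemma scal_mult_var_p_power: "scal a * var_p ^ k = [:monom a k:]"
  by (simp add: scal_def var_p_def poly_const_pow monom_altdef)

lemma var_p_power: "var_p ^ k = [:monom 1 k:]"
  by (simp add: var_p_def poly_const_pow monom_altdef)

lemma gen_F_eq: "gen_F n t z = [:F_poly n t z:]"
  unfolding gen_F_def F_poly_def scal_mult_var_p_power unfolding var_p_power sum_to_poly by simp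

lemma gen_G_eq: "gen_G n \<mu>1 \<mu> z = [:Q_poly n \<mu>1 \<mu> z, -1:]"
  unfolding gen_G_def Q_poly_def scal_mult_var_p_power sum_to_poly
  by (simp add: scal_def var_pbar_def)

lemma coeff_sum_monom_diff:
  "coeff (\<Sum>k=2..n. monom (a k) (n - k)) i = (if i + 2 \<le> n then a (n - i) else 0)"
proof -
  have "coeff (\<Sum>k=2..n. monom (a k) (n - k)) i = (\<Sum>k=2..n. if k = n - i \<and> i \<le> n then a k else 0)"
    unfolding coeff_sum by (rule sum.cong) auto
  also have "\<dots> = (if i + 2 \<le> n then a (n - i) else 0)"
    by (cases "i \<le> n") auto
  finally show ?thesis .
qed

lemma coeff_sum_monom_pred:
  "coeff (\<Sum>k=2..n. monom (a k) (k - 1)) i = (if 1 \<le> i \<and> i < n then a (i + 1) else 0)"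
proof -
  have "coeff (\<Sum>k=2..n. monom (a k) (k - 1)) i = (\<Sum>k=2..n. if k = i + 1 then a k else 0)"
    unfolding coeff_sum by (rule sum.cong) auto
  then show ?thesis by auto
qed

lemma coeff_F_poly:
  "coeff (F_poly n t z) i =
     (if i = n then -1 else if i + 2 \<le> n then fps_X * fps_const (t (n - i) z) else 0)"
  unfolding F_poly_def coeff_add coeff_sum_monom_diff by auto

lemma coeff_Q_poly:
  "n \<ge> 2 \<Longrightarrow> coeff (Q_poly n \<mu>1 \<mu> z) i =
     (if i = 0 then \<mu>1 z else if i < n then fps_const (\<mu> (i + 1) z) else 0)"
  unfolding Q_poly_def coeff_add coeff_sum_monom_pred by (cases i) auto

lemma degree_F_poly_le: "degree (F_poly n t z) \<le> n"
  by (rule degree_le) (simp add: coeff_F_poly)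

lemma degree_Q_poly_le: "n \<ge> 2 \<Longrightarrow> degree (Q_poly n \<mu>1 \<mu> z) \<le> n"
  by (rule degree_le) (simp add: coeff_Q_poly)

text \<open>\<open>Abs_poly\<close> needs almost all coefficients to vanish: beyond the uniform
  bound N the coefficient is the zero function, which D kills.\<close>

lemma coeff_lift_poly:
  assumes "\<And>w. degree (H w) \<le> N" "D (\<lambda>_. 0) z = 0"
  shows "coeff (lift_poly D H z) i = D (\<lambda>w. coeff (H w) i) z"
proof -
  have "coeff (H w) i = 0" if "i > N" for i w
    using assms(1)[of w] that by (intro coeff_eq_0) simp
  then have "\<forall>i>N. D (\<lambda>w. coeff (H w) i) z = 0"
    using assms(2) by simp
  then have "\<forall>\<^sub>\<infinity>i. D (\<lambda>w. coeff (H w) i) z = 0"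
    unfolding MOST_nat by blast
  then show ?thesis
    unfolding lift_poly_def by (simp add: Abs_poly_inverse)
qed

lemma nth_lift_fps: "fps_nth (lift_fps D f z) m = D (\<lambda>w. fps_nth (f w) m) z"
  by (simp add: lift_fps_def)

section \<open>Base derivatives of the generators, for \<open>d_z\<close> and \<open>d_zbar\<close>
  at once\<close>

context
  fixes D :: "(complex \<Rightarrow> complex) \<Rightarrow> complex \<Rightarrow> complex"
  assumes D_const: "\<And>a z. D (\<lambda>_. a) z = 0"
begin

text \<open>The coefficient formulas branch on the index, never on the base point, so D passes into
  the branches.\<close>

lemma nth_if_const:
  "D (\<lambda>w. fps_nth (if b then f w else h w) m) z =
     (if b then D (\<lambda>w. fps_nth (f w) m) z else D (\<lambda>w. fps_nth (h w) m) z)"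
  by simp

lemma lift_fps_const: "lift_fps D (\<lambda>_. a) z = 0"
  by (rule fps_ext) (simp add: nth_lift_fps D_const)

lemma lift_poly_fps_const: "lift_poly (lift_fps D) (\<lambda>_. x) z = 0"
  by (rule poly_eqI) (simp add: coeff_lift_poly[where N = "degree x"] lift_fps_const)

lemma lift_lift_gen_F:
  "lift_poly (lift_poly (lift_fps D)) (gen_F n t) z = [:lift_poly (lift_fps D) (F_poly n t) z:]"
  by (rule poly_eqI)
    (simp add: coeff_lift_poly[where N = 0] lift_poly_fps_const gen_F_eq coeff_pCons split: nat.split)

text \<open>The coefficient -1 of pbar is constant on the base, so only the derivative of Q
  survives.\<close>

lemma lift_lift_gen_G:
  "lift_poly (lift_poly (lift_fps D)) (gen_G n \<mu>1 \<mu>) z =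
     [:lift_poly (lift_fps D) (Q_poly n \<mu>1 \<mu>) z:]"
  by (rule poly_eqI)
    (simp add: coeff_lift_poly[where N = 1] lift_poly_fps_const gen_G_eq coeff_pCons split: nat.split)

text \<open>At order zero F is -p^n, whose coefficient is constant on the base.\<close>

lemma eps_part_0_lift_F: "eps_part 0 (lift_poly (lift_fps D) (F_poly n t) z) = 0"
  by (rule poly_eqI)
    (simp add: coeff_lift_poly[where N = n] degree_F_poly_le lift_fps_const coeff_F_poly
      nth_lift_fps nth_if_const D_const)

lemma eps_part_1_lift_F:
  "eps_part 1 (lift_poly (lift_fps D) (F_poly n t) z) = (\<Sum>k=2..n. monom (D (t k) z) (n - k))"
  by (rule poly_eqI)
    (simp add: coeff_lift_poly[where N = n] degree_F_poly_le lift_fps_const coeff_F_poly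
      coeff_sum_monom_diff nth_lift_fps nth_if_const D_const)

text \<open>\<open>\<mu>1\<close> may have terms of every order in \<epsilon>, while the other
  coefficients of Q sit at order zero.\<close>

lemma eps_part_lift_Q:
  assumes "n \<ge> 2"
  shows "eps_part m (lift_poly (lift_fps D) (Q_poly n \<mu>1 \<mu>) z) =
     [:D (\<lambda>w. fps_nth (\<mu>1 w) m) z:] +
     (if m = 0 then (\<Sum>k=2..n. monom (D (\<mu> k) z) (k - 1)) else 0)"
  using assms
  by (intro poly_eqI)
    (auto simp: coeff_lift_poly[where N = n] degree_Q_poly_le lift_fps_const coeff_Q_poly
      coeff_sum_monom_pred[unfolded One_nat_def] nth_lift_fps nth_if_const D_const coeff_pCons
      split: nat.split)

end

section \<open>Orders zero and one of the generators, and their bracket\<close>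

lemma eps_part_0_F: "eps_part 0 (F_poly n t z) = - monom 1 n"
  by (rule poly_eqI) (simp add: coeff_F_poly)

lemma eps_part_1_F: "eps_part 1 (F_poly n t z) = (\<Sum>k=2..n. monom (t k z) (n - k))"
  by (rule poly_eqI) (simp add: coeff_F_poly coeff_sum_monom_diff)

lemma eps_part_0_Q:
  "n \<ge> 2 \<Longrightarrow> eps_part 0 (Q_poly n \<mu>1 \<mu> z) =
     [:fps_nth (\<mu>1 z) 0:] + (\<Sum>k=2..n. monom (\<mu> k z) (k - 1))"
  by (rule poly_eqI)
    (simp add: coeff_Q_poly coeff_sum_monom_pred[unfolded One_nat_def] coeff_pCons split: nat.split)

text \<open>F is free of pbar, so the third term of the bracket vanishes; the pbar-derivative of G
  is -1, which turns the fourth term into plus the \<open>d_zbar\<close>-derivative of F.\<close>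

lemma poisson_gen:
  "poisson (gen_F n t) (gen_G n \<mu>1 \<mu>) z =
     [:pderiv (F_poly n t z) * lift_poly (lift_fps d_z) (Q_poly n \<mu>1 \<mu>) z
       - lift_poly (lift_fps d_z) (F_poly n t) z * pderiv (Q_poly n \<mu>1 \<mu> z)
       + lift_poly (lift_fps d_zbar) (F_poly n t) z:]"
proof -
  have "pderiv (-1 :: complex fps poly) = 0"
    by (simp add: pderiv_minus)
  then show ?thesis
    unfolding poisson_def base_d_def base_dbar_def fibre_d_p_def fibre_d_pbar_def
    by (simp add: lift_lift_gen_F lift_lift_gen_G gen_F_eq gen_G_eq map_poly_pCons pderiv_pCons)
qed

section \<open>Reduction modulo \<open>p\<^sup>n\<close>\<close>

text \<open>The exponent is n - r exactly for k = j + 2 - r. For r \<ge> 2 put j = r + l, so that k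
  = l + 2; for r = 1 the bound k \<le> n cuts off j = n, hence the separate case.\<close>

lemma coeff_double_sum_monom:
  assumes "n \<ge> 2" "1 \<le> r" "r \<le> n"
  shows "coeff (\<Sum>j=2..n. \<Sum>k=2..n. monom (c j k) (n - j + k - 2)) (n - r) =
     (if r = 1 then \<Sum>j=2..n-1. c j (j + 1) else \<Sum>l=0..n-r. c (r + l) (l + 2))"
proof -
  have "coeff (\<Sum>j=2..n. \<Sum>k=2..n. monom (c j k) (n - j + k - 2)) (n - r) =
      (\<Sum>j=2..n. \<Sum>k=2..n. if k = j + 2 - r \<and> r \<le> j then c j (j + 2 - r) else 0)"
    unfolding coeff_sum using assms by (intro sum.cong) auto
  also have "\<dots> = (\<Sum>j=2..n. if r \<le> j \<and> j + 2 - r \<le> n then c j (j + 2 - r) else 0)"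
    by (intro sum.cong) (auto intro!: sum.neutral)
  also have "\<dots> = (\<Sum>j\<in>{j\<in>{2..n}. r \<le> j \<and> j + 2 - r \<le> n}. c j (j + 2 - r))"
    by (rule sum.inter_filter[symmetric]) simp
  also have "\<dots> = (if r = 1 then \<Sum>j=2..n-1. c j (j + 1) else \<Sum>l=0..n-r. c (r + l) (l + 2))"
  proof (cases "r = 1")
    case True
    then have "{j\<in>{2..n}. r \<le> j \<and> j + 2 - r \<le> n} = {2..n-1}" by auto
    with True show ?thesis by simp
  next
    case False
    have "(\<Sum>j\<in>{j\<in>{2..n}. r \<le> j \<and> j + 2 - r \<le> n}. c j (j + 2 - r)) =
        (\<Sum>l=0..n-r. c (r + l) (l + 2))"
      using assms False
      by (intro sum.reindex_bij_witness[of _ "\<lambda>l. r + l" "\<lambda>j. j - r"])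
        (auto simp: Suc_diff_le)
    with False show ?thesis by simp
  qed
  finally show ?thesis .
qed

lemma pderiv_sum: "pderiv (\<Sum>k\<in>I. f k) = (\<Sum>k\<in>I. pderiv (f k))"
  by (induction I rule: infinite_finite_induct) (simp_all add: pderiv_add)

text \<open>All numbers are values at one point: primes stand for \<partial>, \<open>tb\<close> for
  the \<open>d_zbar\<close>-derivative of t, and \<open>m'\<close> for \<partial> of the order one
  coefficient of \<open>\<mu>1\<close>. Since f0 is nonzero in an integral domain, a0 is forced, and
  only divisibility of the order one remainder by p^n is left.\<close>

lemma order_one_remainder_iff:
  fixes t t' tb \<mu> \<mu>' :: "nat \<Rightarrow> complex"
  assumes n: "n \<ge> 2"
    and m': "of_nat n * m' = - (\<Sum>k=2..n-1. of_nat k * (t' k * \<mu> (k + 1) + t k * \<mu>' (k + 1)))"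
  defines "f0 \<equiv> - monom 1 n"
    and "f1 \<equiv> (\<Sum>k=2..n. monom (t k) (n - k))"
    and "q \<equiv> (\<Sum>k=2..n. monom (\<mu> k) (k - 1))"
    and "q' \<equiv> (\<Sum>k=2..n. monom (\<mu>' k) (k - 1))"
    and "f' \<equiv> (\<Sum>k=2..n. monom (t' k) (n - k))"
    and "fb \<equiv> (\<Sum>k=2..n. monom (tb k) (n - k))"
  shows "(\<exists>a0 a1. pderiv f0 * q' = a0 * f0 \<and>
            pderiv f0 * [:m':] + pderiv f1 * q' - f' * pderiv q + fb = a0 * f1 + a1 * f0) \<longleftrightarrow>
     (\<forall>k\<in>{2..n}. (- tb k + \<mu> 2 * t' k + of_nat k * \<mu>' 2 * t k)
        + (\<Sum>l=1..n-k. of_nat (l + k) * \<mu>' (l + 2) * t (k + l)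
                      + of_nat (l + 1) * \<mu> (l + 2) * t' (k + l)) = 0)"
proof -
  \<comment> \<open>This is the quotient of -n p^(n-1) q' by -p^n; it is a polynomial because q'
    starts at degree one.\<close>
  define a where "a = (\<Sum>k=2..n. monom (of_nat n * \<mu>' k) (k - 2))"
  define C where "C = pderiv f0 * [:m':] + pderiv f1 * q' - f' * pderiv q + fb - a * f1"
  \<comment> \<open>In the weights, \<open>pderiv f1\<close> gives n - j and \<open>a * f1\<close>
    takes away n, leaving -j; \<open>pderiv q\<close> gives k - 1.\<close>
  define S where "S = (\<Sum>j=2..n. \<Sum>k=2..n.
      monom (of_nat j * t j * \<mu>' k + of_nat (k - 1) * t' j * \<mu> k) (n - j + k - 2))"
  have pf0: "pderiv f0 = monom (- of_nat n) (n - 1)"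
    by (simp add: f0_def pderiv_minus pderiv_monom minus_monom)
  have a: "pderiv f0 * q' = a * f0"
    unfolding pf0 unfolding q'_def a_def f0_def using n
    by (simp add: sum_distrib_left sum_distrib_right mult_monom minus_monom sum_negf[symmetric])
       (intro sum.cong; auto simp: mult_monom minus_monom intro!: arg_cong2[where f = monom])
  have f0: "f0 \<noteq> 0" by (simp add: f0_def)
  have "pderiv f1 * q' - f' * pderiv q - a * f1 = - S"
  proof -
    have 1: "pderiv f1 * q' =
        (\<Sum>j=2..n. \<Sum>k=2..n. monom (of_nat (n - j) * t j * \<mu>' k) (n - j + k - 2))"
      unfolding f1_def q'_def pderiv_sum pderiv_monom sum_product mult_monom
    proof (intro sum.cong refl)
      fix j k assume "j \<in> {2..n}" "k \<in> {2..n}"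
      then show "monom (of_nat (n - j) * t j * \<mu>' k) (n - j - 1 + (k - 1)) =
          monom (of_nat (n - j) * t j * \<mu>' k) (n - j + k - 2)"
        \<comment> \<open>at \<open>j = n\<close> the exponents differ by truncation, but the coefficient vanishes\<close>
        by (cases "j = n") (auto intro!: arg_cong2[where f = monom])
    qed
    have 2: "f' * pderiv q =
        (\<Sum>j=2..n. \<Sum>k=2..n. monom (of_nat (k - 1) * t' j * \<mu> k) (n - j + k - 2))"
      unfolding f'_def q_def pderiv_sum pderiv_monom sum_product mult_monom
      by (intro sum.cong refl arg_cong2[where f = monom]) auto
    have 3: "f1 * a = (\<Sum>j=2..n. \<Sum>k=2..n. monom (of_nat n * t j * \<mu>' k) (n - j + k - 2))"
      unfolding a_def f1_def sum_product mult_monom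
      by (intro sum.cong refl arg_cong2[where f = monom]) auto
    show ?thesis
      unfolding mult.commute[of a f1] 1 2 3 S_def sum_subtractf[symmetric] sum_negf[symmetric]
    proof (intro sum.cong refl)
      fix j k assume "j \<in> {2..n}" "k \<in> {2..n}"
      then show "monom (of_nat (n - j) * t j * \<mu>' k) (n - j + k - 2)
          - monom (of_nat (k - 1) * t' j * \<mu> k) (n - j + k - 2)
          - monom (of_nat n * t j * \<mu>' k) (n - j + k - 2) =
          - monom (of_nat j * t j * \<mu>' k + of_nat (k - 1) * t' j * \<mu> k) (n - j + k - 2)"
        by (simp add: diff_monom minus_monom of_nat_diff algebra_simps)
    qed
  qed
  then have C_eq: "C = monom (- of_nat n * m') (n - 1) + fb - S"
    unfolding C_def pf0 by (simp add: algebra_simps smult_monom)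
  have "(\<exists>a0 a1. pderiv f0 * q' = a0 * f0 \<and>
            pderiv f0 * [:m':] + pderiv f1 * q' - f' * pderiv q + fb = a0 * f1 + a1 * f0) \<longleftrightarrow>
     (\<exists>a1. C = a1 * f0)"
  proof -
    have "a0 = a" if "pderiv f0 * q' = a0 * f0" for a0
      using that a f0 by simp
    then show ?thesis using a unfolding C_def by (auto simp: algebra_simps)
  qed
  also have "\<dots> \<longleftrightarrow> f0 dvd C" by (auto simp: dvd_def mult.commute)
  also have "\<dots> \<longleftrightarrow> (\<forall>i<n. coeff C i = 0)"
    by (simp add: f0_def monom_1_dvd_iff')
  also have "\<dots> \<longleftrightarrow> (\<forall>r\<in>{1..n}. coeff C (n - r) = 0)"
  proof safe
    fix i assume *: "\<forall>r\<in>{1..n}. coeff C (n - r) = 0" "i < n"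
    then show "coeff C i = 0" using bspec[OF *(1), of "n - i"] by simp
  qed auto
  also have "\<dots> \<longleftrightarrow> (\<forall>r\<in>{2..n}. coeff C (n - r) = 0)"
  proof -
    \<comment> \<open>The degree of fb is at most n - 2, so at p^(n-1) the double sum meets only
      \<open>m'\<close>, and the assumed value of \<open>m'\<close> cancels it.\<close>
    have "coeff C (n - 1) = - (of_nat n * m')
        - (\<Sum>j=2..n-1. of_nat j * t j * \<mu>' (j + 1) + of_nat j * t' j * \<mu> (j + 1))"
      unfolding C_eq fb_def S_def coeff_diff coeff_add coeff_sum_monom_diff
        coeff_double_sum_monom[OF n le_refl order_trans[OF one_le_numeral n]] using n by simp
    then have "coeff C (n - 1) = 0"
      unfolding m' by (simp add: algebra_simps)
    moreover have "{1..n} = insert 1 {2..n}" using n by auto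
    ultimately show ?thesis by simp
  qed
  also have "\<dots> \<longleftrightarrow> (\<forall>k\<in>{2..n}. (- tb k + \<mu> 2 * t' k + of_nat k * \<mu>' 2 * t k)
        + (\<Sum>l=1..n-k. of_nat (l + k) * \<mu>' (l + 2) * t (k + l)
                      + of_nat (l + 1) * \<mu> (l + 2) * t' (k + l)) = 0)"
  proof (intro ball_cong refl)
    fix r assume r: "r \<in> {2..n}"
    have "coeff C (n - r) = tb r - (\<Sum>l=0..n-r. of_nat (r + l) * t (r + l) * \<mu>' (l + 2)
        + of_nat (l + 2 - 1) * t' (r + l) * \<mu> (l + 2))"
      unfolding C_eq fb_def S_def coeff_diff coeff_add coeff_sum_monom_diff using r n
      by (subst coeff_double_sum_monom) auto
    \<comment> \<open>The summand l = 0 supplies the terms in \<open>\<mu> 2\<close> and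
      \<open>\<mu>' 2\<close>.\<close>
    also have "\<dots> = - ((- tb r + \<mu> 2 * t' r + of_nat r * \<mu>' 2 * t r)
        + (\<Sum>l=1..n-r. of_nat (l + r) * \<mu>' (l + 2) * t (r + l)
                      + of_nat (l + 1) * \<mu> (l + 2) * t' (r + l)))"
      by (simp add: sum.atLeast_Suc_atMost algebra_simps numeral_2_eq_2)
    finally show "coeff C (n - r) = 0 \<longleftrightarrow> (- tb r + \<mu> 2 * t' r + of_nat r * \<mu>' 2 * t r)
        + (\<Sum>l=1..n-r. of_nat (l + r) * \<mu>' (l + 2) * t (r + l)
                      + of_nat (l + 1) * \<mu> (l + 2) * t' (r + l)) = 0"
      by (simp only: neg_equal_0_iff_equal)
  qed
  finally show ?thesis .
qed

section \<open>The equivalence at each point of each chart\<close>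

theorem theorem7p3:
  fixes X :: "'a topology" and A :: "'a chart set" and g n :: nat
    and \<mu> t :: "nat \<Rightarrow> 'a chart \<Rightarrow> complex \<Rightarrow> complex"
    and \<mu>1 :: "'a chart \<Rightarrow> complex \<Rightarrow> complex fps"
  assumes "closed_riemann_surface X A" and "has_genus X g" and "g \<ge> 2"
    and "n \<ge> 2"
    and "higher_beltrami A n \<mu>"
    and "\<forall>k\<in>{2..n}. smooth_section A (int k) 0 (t k)"
    and "is_mu1 A n \<mu> t \<mu>1"
  shows "(\<forall>c\<in>A. \<forall>z\<in>chart_img c.
            zero_mod_ideal_mod_t2
              (poisson (gen_F n (\<lambda>k. t k c)) (gen_G n (\<mu>1 c) (\<lambda>k. \<mu> k c)) z)
              (ideal2 (gen_F n (\<lambda>k. t k c) z) (gen_G n (\<mu>1 c) (\<lambda>k. \<mu> k c) z)))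
         \<longleftrightarrow> in_cotangent_moduli A n \<mu> t"
proof -
  have "zero_mod_ideal_mod_t2
          (poisson (gen_F n (\<lambda>k. t k c)) (gen_G n (\<mu>1 c) (\<lambda>k. \<mu> k c)) z)
          (ideal2 (gen_F n (\<lambda>k. t k c) z) (gen_G n (\<mu>1 c) (\<lambda>k. \<mu> k c) z)) \<longleftrightarrow>
        (\<forall>k\<in>{2..n}.
          (- d_zbar (t k c) z + \<mu> 2 c z * d_z (t k c) z + of_nat k * d_z (\<mu> 2 c) z * t k c z)
          + (\<Sum>l=1..n-k. of_nat (l + k) * d_z (\<mu> (l + 2) c) z * t (k + l) c z
                        + of_nat (l + 1) * \<mu> (l + 2) c z * d_z (t (k + l) c) z) = 0)"
    if c: "c \<in> A" and z: "z \<in> chart_img c" for c z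
  proof -
    have op: "open (chart_img c)"
      using assms(1) c by (auto simp: closed_riemann_surface_def)
    have dt: "t k c differentiable (at z)" if "k \<in> {2..n}" for k
      using smooth_section_differentiable[OF _ c op z, of "int k" 0 "t k"] assms(6) that by blast
    have d\<mu>: "\<mu> k c differentiable (at z)" if "k \<in> {2..n}" for k
      using smooth_section_differentiable[OF _ c op z, of "1 - int k" 1 "\<mu> k"] assms(5) that
      unfolding higher_beltrami_def by blast
    \<comment> \<open>Divisibility by \<epsilon>^2 prescribes exactly these two coefficients; being
      known on the whole open chart image, they can be differentiated.\<close>
    have \<mu>1: "fps_nth (\<mu>1 c w) 0 = 0"
      "fps_nth (\<mu>1 c w) 1 = (\<Sum>k=2..n-1. - (of_nat k / of_nat n) * (t k c w * \<mu> (k + 1) c w))"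
      if "w \<in> chart_img c" for w
      using assms(7) c that
      by (auto simp: is_mu1_def X_power2_dvd_iff fps_sum_nth fps_mult_nth_1 sum_negf add_eq_0_iff
          mult.assoc)
    have d0: "d_z (\<lambda>w. fps_nth (\<mu>1 c w) 0) z = 0"
      using d_z_cong_open[OF op z, of "\<lambda>w. fps_nth (\<mu>1 c w) 0" "\<lambda>_. 0"] \<mu>1 by simp
    have diff: "(\<lambda>w. t k c w * \<mu> (k + 1) c w) differentiable (at z)" if "k \<in> {2..n-1}" for k
      using dt[of k] d\<mu>[of "k + 1"] that by (intro differentiable_mult) auto
    have "d_z (\<lambda>w. fps_nth (\<mu>1 c w) 1) z =
        d_z (\<lambda>w. \<Sum>k=2..n-1. - (of_nat k / of_nat n) * (t k c w * \<mu> (k + 1) c w)) z"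
      using diff by (intro d_z_cong_open[OF op z] \<mu>1) (auto intro!: differentiable_sum differentiable_mult)
    also have "\<dots> = (\<Sum>k=2..n-1. d_z (\<lambda>w. - (of_nat k / of_nat n) * (t k c w * \<mu> (k + 1) c w)) z)"
      using diff by (intro d_z_sum) (auto intro!: differentiable_mult)
    also have "\<dots> = (\<Sum>k=2..n-1. - (of_nat k / of_nat n) *
        (d_z (t k c) z * \<mu> (k + 1) c z + t k c z * d_z (\<mu> (k + 1) c) z))"
    proof (rule sum.cong[OF refl])
      fix k assume k: "k \<in> {2..n-1}"
      then have k': "k \<in> {2..n}" "k + 1 \<in> {2..n}" using assms(4) by auto
      show "d_z (\<lambda>w. - (of_nat k / of_nat n) * (t k c w * \<mu> (k + 1) c w)) z =
        - (of_nat k / of_nat n) *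
        (d_z (t k c) z * \<mu> (k + 1) c z + t k c z * d_z (\<mu> (k + 1) c) z)"
        by (subst d_z_mult[OF differentiable_const diff[OF k]], subst d_z_const,
            subst d_z_mult[OF dt[OF k'(1)] d\<mu>[OF k'(2)]]) simp
    qed
    \<comment> \<open>Multiplication by n clears the denominators and gives the form required of
      \<open>m'\<close>.\<close>
    finally have d1: "of_nat n * d_z (\<lambda>w. fps_nth (\<mu>1 c w) 1) z = - (\<Sum>k=2..n-1. of_nat k *
        (d_z (t k c) z * \<mu> (k + 1) c z + t k c z * d_z (\<mu> (k + 1) c) z))"
      using assms(4) by (simp add: sum_distrib_left sum_negf[symmetric])
    \<comment> \<open>Orders zero and one of the bracket become the two equations of
      \<open>order_one_remainder_iff\<close>. The base derivatives of F have no part of order zero,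
      so they enter only the second equation.\<close>
    show ?thesis
      unfolding poisson_gen gen_F_eq gen_G_eq zero_mod_ideal_mod_t2_iff eps_part_add eps_part_diff
        eps_part_0_mult eps_part_1_mult eps_part_pderiv eps_part_0_F eps_part_1_F
        eps_part_0_Q[OF assms(4)] eps_part_0_lift_F[where D = d_z, OF d_z_const]
        eps_part_0_lift_F[where D = d_zbar, OF d_zbar_const]
        eps_part_1_lift_F[where D = d_z, OF d_z_const]
        eps_part_1_lift_F[where D = d_zbar, OF d_zbar_const]
        eps_part_lift_Q[where D = d_z, OF d_z_const assms(4)] d0 \<mu>1(1)[OF z]
      using order_one_remainder_iff[OF assms(4) d1, of "\<lambda>k. d_zbar (t k c) z"] by simp
  qed
  then show ?thesis unfolding in_cotangent_moduli_def by blast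
qed

end
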